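(* Let $\mathbf u=(u_n)_{n\in\mathbb N}$ be an arithmetic sequence, let $\mathcal I$ be a translation invariant free $P$-ideal of $\mathbb N$ and let $x\in[0,1)$ with $S=\mathrm{supp}(x)$ and $S_b=\mathrm{supp}_b(x)$. Suppose that $\mathbf u$ has the $\mathcal I$-splitting property witnessed by the partition $\mathbb N_+=B\sqcup D$. Then $\bar x\in t^{\mathcal I}_{\mathbf u}(\mathbb T)$ if and only if the following three conditions hold: (1) $(B\cap S)+1\subseteq^{\mathcal I}S$, $B\cap S\subseteq^{\mathcal I}S_b$, and if $B\cap S\notin\mathcal I$ then there exists $C\subseteq_{\mathcal I}B\cap S$ such that $\lim_{n\in C}\frac{c_{n+1}+1}{b_{n+1}}=1$; (2) if $B\setminus S\notin\mathcal I$, then there exists $C\subseteq_{\mathcal I}B\setminus S$ such that $\lim_{n\in C}\frac{c_{n+1}}{b_{n+1}}=0$; (3) if $D\cap S\notin\mathcal I$, then there exists $E\subseteq_{\mathcal I}D\cap S$ such that $\lim_{n\in E}\varphi\left(\frac{c_n}{b_n}\right)=0$ in $\mathbb T$.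
   Context: $\mathbb N=\{0,1,2,\dots\}$, $\mathbb N_+=\mathbb N\setminus\{0\}$; $\mathbb T=\mathbb R/\mathbb Z$ with canonical projection $\varphi\colon\mathbb R\to\mathbb T$, and $\bar x=\varphi(x)$. For $A\subseteq\mathbb N$ and $n\in\mathbb Z$, $A+n=\{a+n:a\in A\}$. For an infinite $A\subseteq\mathbb N$, $\lim_{n\in A}$ is the limit as $n\to\infty$ along $A$. An ideal of $\mathbb N$ is a non-empty $\mathcal I\subseteq\mathcal P(\mathbb N)$ closed under finite unions and subsets. It is free if it contains all finite subsets of $\mathbb N$; translation invariant if $(A+n)\cap\mathbb N\in\mathcal I$ for all $A\in\mathcal I$, $n\in\mathbb Z$; a $P$-ideal if for every countable family $\{A_n:n\in\mathbb N\}\subseteq\mathcal I$ there is $U\in\mathcal I$ with $A_n\setminus U$ finite for all $n$. Write $A\subseteq^{\mathcal I}B$ if $A\setminus B\in\mathcal I$, and $A\subseteq_{\mathcal I}B$ if $A\subseteq B$ and $B\setminus A\in\mathcal I$. A sequence $(x_n)$ in $\mathbb T$ $\mathcal I$-converges to $y$ if $\{n\in\mathbb N:x_n\notin U\}\in\mathcal I$ for every neighborhood $U$ of $y$; $t^{\mathcal I}_{\mathbf u}(\mathbb T)=\{y\in\mathbb T: u_ny \ \mathcal I\text{-converges to }0\}$. A sequence $\mathbf u=(u_n)_{n\in\mathbb N}$ of integers is arithmetic if it is strictly increasing, $u_0=1$ and $u_n\mid u_{n+1}$ for all $n\in\mathbb N$; put $b_n=u_n/u_{n-1}$ for $n\in\mathbb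 N_+$. Every $x\in[0,1)$ has a unique representation $x=\sum_{n=1}^\infty\frac{c_n}{u_n}$ with $c_n\in\mathbb N$, $c_n<b_n$ for all $n\in\mathbb N_+$ and $c_n<b_n-1$ for infinitely many $n$. Put $\mathrm{supp}(x)=\{n\in\mathbb N_+:c_n\ne0\}$ and $\mathrm{supp}_b(x)=\{n\in\mathbb N_+:c_n=b_n-1\}$. An infinite $A\subseteq\mathbb N_+$ is $b$-bounded if $(b_n)_{n\in A}$ is bounded, and $b$-divergent if $(b_n)_{n\in A}$ diverges to infinity (finite sets are regarded as both). A set $X$ is $b$-bounded mod $\mathcal I$ (resp. $b$-divergent mod $\mathcal I$) if there is a $b$-bounded (resp. $b$-divergent) $A\subseteq_{\mathcal I}X$. The sequence $\mathbf u$ has the $\mathcal I$-splitting property, witnessed by a partition $\mathbb N_+=B\sqcup D$, if: each of $B$ and $D$ is either empty or not in $\mathcal I$; if $B\notin\mathcal I$ then $B$ is $b$-bounded mod $\mathcal I$; if $D\notin\mathcal I$ then $D$ is $b$-divergent mod $\mathcal I$. *)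

theory Defs
  imports "HOL-Analysis.Analysis"
begin

definition cong_int :: "real \<Rightarrow> real \<Rightarrow> bool" where
  "cong_int x y \<longleftrightarrow> x - y \<in> \<int>"

lemma equivp_cong_int: "equivp cong_int"
proof (rule equivpI)
  show "reflp cong_int" by (simp add: reflp_def cong_int_def)
  show "symp cong_int"
    unfolding symp_def cong_int_def by (metis Ints_minus minus_diff_eq)
  show "transp cong_int"
    unfolding transp_def cong_int_def
    by (metis Ints_add add_diff_eq diff_add_cancel)
qed

quotient_type circle = real / cong_int
  morphisms rep_circle proj
  by (rule equivp_cong_int)

instantiation circle :: ab_group_add
begin

lift_definition zero_circle :: circle is "0 :: real" .

lift_definition plus_circle :: "circle \<Rightarrow> circle \<Rightarrow> circle" is "(+)"
  unfolding cong_int_def by (metis Ints_add add_diff_add)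

lift_definition uminus_circle :: "circle \<Rightarrow> circle" is uminus
  unfolding cong_int_def by (metis Ints_minus minus_diff_minus)

definition minus_circle :: "circle \<Rightarrow> circle \<Rightarrow> circle" where
  "minus_circle x y = x + - y"

instance
proof
  fix a b c :: circle
  show "a + b + c = a + (b + c)" by transfer (simp add: cong_int_def)
  show "a + b = b + a" by transfer (simp add: cong_int_def)
  show "0 + a = a" by transfer (simp add: cong_int_def)
  show "- a + a = 0" by transfer (simp add: cong_int_def)
  show "a - b = a + - b" by (simp add: minus_circle_def)
qed

end

instantiation circle :: topological_space
begin

definition open_circle :: "circle set \<Rightarrow> bool" where
  "open_circle U \<longleftrightarrow> open (proj -` U)"

instance
  by standard (auto simp: open_circle_def vimage_Union vimage_Int)

end

lift_definition int_mult :: "int \<Rightarrow> circle \<Rightarrow> circle" is "\<lambda>k x. of_int k * x"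
  unfolding cong_int_def by (metis Ints_mult Ints_of_int right_diff_distrib)

definition is_ideal :: "nat set set \<Rightarrow> bool" where
  "is_ideal I \<longleftrightarrow> I \<noteq> {} \<and> (\<forall>A\<in>I. \<forall>B\<in>I. A \<union> B \<in> I) \<and> (\<forall>A\<in>I. \<forall>B. B \<subseteq> A \<longrightarrow> B \<in> I)"

definition free_ideal :: "nat set set \<Rightarrow> bool" where
  "free_ideal I \<longleftrightarrow> is_ideal I \<and> (\<forall>F. finite F \<longrightarrow> F \<in> I)"

(* shift A n is the part of the integer translate A + n that lies in the natural numbers. *)
definition shift :: "nat set \<Rightarrow> int \<Rightarrow> nat set" where
  "shift A n = {m. \<exists>a\<in>A. int m = int a + n}"

definition translation_invariant :: "nat set set \<Rightarrow> bool" where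
  "translation_invariant I \<longleftrightarrow> (\<forall>A\<in>I. \<forall>n. shift A n \<in> I)"

definition P_ideal :: "nat set set \<Rightarrow> bool" where
  "P_ideal I \<longleftrightarrow> is_ideal I \<and>
     (\<forall>A :: nat \<Rightarrow> nat set. range A \<subseteq> I \<longrightarrow> (\<exists>U\<in>I. \<forall>n. finite (A n - U)))"

definition almost_subset :: "nat set set \<Rightarrow> nat set \<Rightarrow> nat set \<Rightarrow> bool" where
  "almost_subset I A B \<longleftrightarrow> A - B \<in> I"

definition subset_mod :: "nat set set \<Rightarrow> nat set \<Rightarrow> nat set \<Rightarrow> bool" where
  "subset_mod I A B \<longleftrightarrow> A \<subseteq> B \<and> B - A \<in> I"

definition ideal_converges ::
    "nat set set \<Rightarrow> (nat \<Rightarrow> 'a::topological_space) \<Rightarrow> 'a \<Rightarrow> bool" where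
  "ideal_converges I X y \<longleftrightarrow> (\<forall>U. (\<forall>\<^sub>F z in nhds y. z \<in> U) \<longrightarrow> {n. X n \<notin> U} \<in> I)"

definition characterized :: "nat set set \<Rightarrow> (nat \<Rightarrow> int) \<Rightarrow> circle set" where
  "characterized I u = {y. ideal_converges I (\<lambda>n. int_mult (u n) y) 0}"

(* Neighbourhoods of infinity in A.  This filter is trivial when A is finite. *)
definition along :: "nat set \<Rightarrow> nat filter" where
  "along A = inf sequentially (principal A)"

definition arithmetic_seq :: "(nat \<Rightarrow> int) \<Rightarrow> bool" where
  "arithmetic_seq u \<longleftrightarrow> strict_mono u \<and> u 0 = 1 \<and> (\<forall>n. u n dvd u (Suc n))"

(* Only the values at n >= 1 are meaningful. *)
definition ratio :: "(nat \<Rightarrow> int) \<Rightarrow> nat \<Rightarrow> int" where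
  "ratio u n = u n div u (n - 1)"

(* Digits are indexed by positive integers; c 0 = 0 is a normalization. *)
definition expansion :: "(nat \<Rightarrow> int) \<Rightarrow> real \<Rightarrow> (nat \<Rightarrow> nat) \<Rightarrow> bool" where
  "expansion u x c \<longleftrightarrow> c 0 = 0 \<and>
     (\<lambda>n. real (c (Suc n)) / of_int (u (Suc n))) sums x \<and>
     (\<forall>n\<ge>1. int (c n) < ratio u n) \<and>
     infinite {n. n \<ge> 1 \<and> int (c n) < ratio u n - 1}"

definition digit :: "(nat \<Rightarrow> int) \<Rightarrow> real \<Rightarrow> nat \<Rightarrow> nat" where
  "digit u x = (THE c. expansion u x c)"

lemma arithmetic_seq_Suc:
  assumes "arithmetic_seq u"
  shows "u (Suc n) = ratio u (Suc n) * u n" and "u n \<ge> int n + 1" and "ratio u (Suc n) \<ge> 2"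
proof -
  have *: "u n < u (Suc n)" "u n dvd u (Suc n)" for n
    using assms by (auto simp: arithmetic_seq_def strict_mono_def)
  show ge: "u n \<ge> int n + 1" for n
  proof (induction n)
    case 0 then show ?case using assms by (simp add: arithmetic_seq_def)
  next
    case (Suc n) then show ?case using *(1)[of n] by simp
  qed
  show eq: "u (Suc n) = ratio u (Suc n) * u n"
    using *(2)[of n] by (simp add: ratio_def)
  show "ratio u (Suc n) \<ge> 2"
  proof (rule ccontr)
    assume "\<not> ratio u (Suc n) \<ge> 2"
    then have "ratio u (Suc n) \<le> 1" by simp
    then have "ratio u (Suc n) * u n \<le> 1 * u n"
      using ge[of n] by (intro mult_right_mono) auto
    then show False using eq *(1)[of n] by simp
  qed
qed

lemma arithmetic_seq_inverse_tendsto: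
  assumes "arithmetic_seq u"
  shows "(\<lambda>n. 1 / of_int (u n) :: real) \<longlonglongrightarrow> 0"
proof (rule tendsto_sandwich[of "\<lambda>n. 0" _ _ "\<lambda>n. 1 / real (Suc n)"])
  have ge: "real_of_int (u n) \<ge> real (Suc n)" for n
    using arithmetic_seq_Suc(2)[OF assms, of n] by linarith
  show "\<forall>\<^sub>F n in sequentially. (0::real) \<le> 1 / of_int (u n)"
    using ge by (intro always_eventually allI) (smt (verit) divide_nonneg_nonneg of_nat_0_le_iff)
  show "\<forall>\<^sub>F n in sequentially. 1 / of_int (u n) \<le> 1 / real (Suc n)"
    using ge by (intro always_eventually allI frac_le) auto
  show "(\<lambda>n. 1 / real (Suc n)) \<longlonglongrightarrow> 0"
    using LIMSEQ_inverse_real_of_nat by (simp add: inverse_eq_divide)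
qed simp

lemma expansion_floor:
  assumes u: "arithmetic_seq u" and c: "expansion u x c"
  shows "of_int \<lfloor>of_int (u n) * x\<rfloor> = of_int (u n) * (\<Sum>k<n. real (c (Suc k)) / of_int (u (Suc k)))"
proof -
  define P where "P n = (\<Sum>k<n. real (c (Suc k)) / of_int (u (Suc k)))" for n
  define Q where "Q n = P n + 1 / of_int (u n)" for n
  have pos: "real_of_int (u n) > 0" for n
    using arithmetic_seq_Suc(2)[OF u, of n] by linarith
  have rec: "real_of_int (u (Suc n)) = of_int (ratio u (Suc n)) * of_int (u n)" for n
    using arithmetic_seq_Suc(1)[OF u, of n] by (metis of_int_mult)
  have lim: "P \<longlonglongrightarrow> x"
    using c by (simp add: expansion_def sums_def P_def[abs_def])
  have limQ: "Q \<longlonglongrightarrow> x"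
    using tendsto_add[OF lim arithmetic_seq_inverse_tendsto[OF u]] by (simp add: Q_def[abs_def])
  have inc: "incseq P"
    by (rule incseq_SucI) (use pos in \<open>simp add: P_def less_imp_le\<close>)
  have step: "Q (Suc n) = P n + (real (c (Suc n)) + 1) / of_int (u (Suc n))" for n
    by (simp add: P_def Q_def add_divide_distrib)
  have one: "1 / of_int (u n) = of_int (ratio u (Suc n)) / real_of_int (u (Suc n))" for n
    using rec[of n] pos[of n] pos[of "Suc n"] by (auto simp: field_simps)
  have cb: "int (c (Suc n)) < ratio u (Suc n)" for n
    using c by (simp add: expansion_def)
  have le: "Q (Suc n) \<le> Q n" for n
  proof -
    have "real (c (Suc n)) + 1 \<le> of_int (ratio u (Suc n))" using cb[of n] by linarith
    then show ?thesis unfolding step unfolding Q_def one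
      using pos[of "Suc n"] by (simp add: divide_right_mono)
  qed
  then have dec: "decseq Q" by (rule decseq_SucI)
  have "x \<ge> P n" using incseq_le[OF inc lim] .
  moreover have "x < Q n"
  proof -
    have "infinite {n. n \<ge> 1 \<and> int (c n) < ratio u n - 1}" using c by (simp add: expansion_def)
    then obtain m where m: "m > n" "int (c m) < ratio u m - 1"
      unfolding infinite_nat_iff_unbounded by blast
    then obtain k where k: "m = Suc k" "n \<le> k" by (cases m) auto
    have "int (c (Suc k)) < ratio u (Suc k) - 1" using m(2) k(1) by simp
    then have "real (c (Suc k)) + 1 < of_int (ratio u (Suc k))" by linarith
    then have "Q (Suc k) < Q k" unfolding step unfolding Q_def one
      using pos[of "Suc k"] by (simp add: divide_strict_right_mono)
    moreover have "x \<le> Q (Suc k)" using decseq_ge[OF dec limQ] .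
    moreover have "Q k \<le> Q n" using dec k(2) by (simp add: decseq_def)
    ultimately show ?thesis by linarith
  qed
  moreover have "\<exists>z. real_of_int (u n) * P n = of_int z" for n
  proof (induction n)
    case 0 show ?case by (rule exI[of _ 0]) (simp add: P_def)
  next
    case (Suc n)
    then obtain z where z: "real_of_int (u n) * P n = of_int z" by blast
    have "real_of_int (u (Suc n)) * P (Suc n) = real_of_int (u (Suc n)) * P n + real (c (Suc n))"
      using pos[of "Suc n"] by (simp add: P_def field_simps)
    also have "\<dots> = of_int (ratio u (Suc n)) * of_int z + real (c (Suc n))"
      unfolding rec using z by (simp add: mult.assoc)
    also have "\<dots> = of_int (ratio u (Suc n) * z + int (c (Suc n)))" by simp
    finally show ?case by blast
  qed
  then obtain z where z: "real_of_int (u n) * P n = of_int z" by blast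
  ultimately have "of_int z \<le> of_int (u n) * x" "of_int (u n) * x < of_int z + 1"
    using pos[of n] z[symmetric] by (simp_all add: Q_def field_simps)
  then have "\<lfloor>of_int (u n) * x\<rfloor> = z" by (simp add: floor_eq_iff)
  then show ?thesis using z by (simp add: P_def)
qed

lemma expansion_unique:
  assumes u: "arithmetic_seq u" and c: "expansion u x c" and d: "expansion u x d"
  shows "c = d"
proof
  fix n
  have pos: "real_of_int (u n) > 0" for n
    using arithmetic_seq_Suc(2)[OF u, of n] by linarith
  have eq: "(\<Sum>k<n. real (c (Suc k)) / of_int (u (Suc k))) =
      (\<Sum>k<n. real (d (Suc k)) / of_int (u (Suc k)))" for n
    using expansion_floor[OF u c, of n] expansion_floor[OF u d, of n] pos[of n] by auto
  show "c n = d n"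
  proof (cases n)
    case 0 then show ?thesis using c d by (simp add: expansion_def)
  next
    case (Suc m)
    show ?thesis using eq[of m] eq[of "Suc m"] pos[of "Suc m"] Suc by simp
  qed
qed

lemma expansion_exists:
  assumes u: "arithmetic_seq u" and x: "0 \<le> x" "x < 1"
  shows "\<exists>c. expansion u x c"
proof -
  define f where "f n = \<lfloor>of_int (u n) * x\<rfloor>" for n
  define c where "c n = (if n = 0 then 0 else nat (f n - ratio u n * f (n - 1)))" for n
  have pos: "real_of_int (u n) > 0" for n
    using arithmetic_seq_Suc(2)[OF u, of n] by linarith
  have rec: "real_of_int (u (Suc n)) = of_int (ratio u (Suc n)) * of_int (u n)" for n
    using arithmetic_seq_Suc(1)[OF u, of n] by (metis of_int_mult)
  have rpos: "real_of_int (ratio u (Suc n)) \<ge> 2" for n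
    using arithmetic_seq_Suc(3)[OF u, of n] by linarith
  have f: "of_int (f n) \<le> of_int (u n) * x" "of_int (u n) * x < of_int (f n) + 1" for n
    unfolding f_def by linarith+
  have lo: "ratio u (Suc n) * f n \<le> f (Suc n)" for n
  proof -
    have "of_int (ratio u (Suc n)) * of_int (f n) \<le> of_int (ratio u (Suc n)) * (of_int (u n) * x)"
      using rpos[of n] f(1)[of n] by (intro mult_left_mono) auto
    then have "real_of_int (ratio u (Suc n) * f n) \<le> of_int (u (Suc n)) * x" by (simp add: rec)
    then show ?thesis unfolding f_def[of "Suc n"] by (rule le_floor_iff[THEN iffD2])
  qed
  have hi: "f (Suc n) < ratio u (Suc n) * (f n + 1)" for n
  proof -
    have "of_int (ratio u (Suc n)) * (of_int (u n) * x) < of_int (ratio u (Suc n)) * (of_int (f n) + 1)"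
      using rpos[of n] f(2)[of n] by (intro mult_strict_left_mono) auto
    then have "of_int (u (Suc n)) * x < real_of_int (ratio u (Suc n) * (f n + 1))" by (simp add: rec)
    then show ?thesis unfolding f_def[of "Suc n"] by (rule floor_less_iff[THEN iffD2])
  qed
  have c: "int (c (Suc n)) = f (Suc n) - ratio u (Suc n) * f n" for n
    using lo[of n] by (simp add: c_def)
  have rc: "real (c (Suc n)) = of_int (f (Suc n)) - of_int (ratio u (Suc n)) * of_int (f n)" for n
    using c[of n] by (metis of_int_diff of_int_mult of_int_of_nat_eq)
  have f0: "f 0 = 0" using u x by (simp add: f_def arithmetic_seq_def floor_eq_iff)
  have P: "(\<Sum>k<n. real (c (Suc k)) / of_int (u (Suc k))) = of_int (f n) / of_int (u n)" for n
  proof (induction n)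
    case 0 show ?case by (simp add: f0)
  next
    case (Suc n)
    have "of_int (f n) / of_int (u n) = of_int (ratio u (Suc n)) * of_int (f n) / real_of_int (u (Suc n))"
      using rpos[of n] pos[of n] unfolding rec by simp
    then show ?case using Suc by (simp add: rc diff_divide_distrib)
  qed
  have sums: "(\<lambda>n. real (c (Suc n)) / of_int (u (Suc n))) sums x"
    unfolding sums_def P
  proof (rule tendsto_sandwich[of "\<lambda>n. x - 1 / of_int (u n)" _ _ "\<lambda>n. x"])
    show "\<forall>\<^sub>F n in sequentially. x - 1 / of_int (u n) \<le> of_int (f n) / of_int (u n)"
    proof (intro always_eventually allI)
      fix n show "x - 1 / of_int (u n) \<le> of_int (f n) / of_int (u n)"
      proof -
        have "x \<le> (of_int (f n) + 1) / of_int (u n)"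
          using f(2)[of n] pos[of n] by (simp add: pos_le_divide_eq mult.commute)
        then show ?thesis by (simp add: add_divide_distrib)
      qed
    qed
    show "\<forall>\<^sub>F n in sequentially. of_int (f n) / of_int (u n) \<le> x"
    proof (intro always_eventually allI)
      fix n show "of_int (f n) / of_int (u n) \<le> x"
        using f(1)[of n] pos[of n] by (simp add: field_simps)
    qed
    show "(\<lambda>n. x - 1 / of_int (u n)) \<longlonglongrightarrow> x"
      using tendsto_diff[OF tendsto_const arithmetic_seq_inverse_tendsto[OF u], of x] by simp
  qed simp
  have lt: "int (c n) < ratio u n" if "n \<ge> 1" for n
  proof -
    obtain m where "n = Suc m" using \<open>n \<ge> 1\<close> by (cases n) auto
    then show ?thesis using c[of m] hi[of m] by (simp add: algebra_simps)
  qed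
  have inf: "infinite {n. n \<ge> 1 \<and> int (c n) < ratio u n - 1}"
  proof
    assume "finite {n. n \<ge> 1 \<and> int (c n) < ratio u n - 1}"
    then obtain N where N: "\<And>n. n \<ge> 1 \<Longrightarrow> int (c n) < ratio u n - 1 \<Longrightarrow> n \<le> N"
      by (auto simp: finite_nat_set_iff_bounded_le)
    define g where "g n = of_int (f n) + 1 - of_int (u n) * x" for n
    have gpos: "0 < g n" "g n \<le> 1" for n using f[of n] by (auto simp: g_def)
    have gS: "g (Suc n) \<ge> 2 * g n" if "n \<ge> N" for n
    proof -
      have "\<not> int (c (Suc n)) < ratio u (Suc n) - 1" using N[of "Suc n"] that by auto
      then have "int (c (Suc n)) = ratio u (Suc n) - 1" using lt[of "Suc n"] by simp
      then have "real (c (Suc n)) = of_int (ratio u (Suc n)) - 1" by linarith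
      then have "of_int (f (Suc n)) = of_int (ratio u (Suc n)) * of_int (f n) + of_int (ratio u (Suc n)) - (1::real)"
        using rc[of n] by simp
      then have "g (Suc n) = of_int (ratio u (Suc n)) * g n"
        by (simp add: g_def rec algebra_simps)
      then show ?thesis using rpos[of n] gpos(1)[of n] by simp
    qed
    have pw: "g (N + k) \<ge> 2 ^ k * g N" for k
    proof (induction k)
      case (Suc k) then show ?case using gS[of "N + k"] by simp
    qed simp
    obtain k where "1 / g N < 2 ^ k" using real_arch_pow[of 2 "1 / g N"] by auto
    then have "1 < 2 ^ k * g N" using gpos(1)[of N] by (simp add: field_simps)
    then show False using pw[of k] gpos(2)[of "N + k"] by linarith
  qed
  show ?thesis
    by (rule exI[of _ c]) (use sums lt inf in \<open>simp add: expansion_def c_def\<close>)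
qed

lemma expansion_digit:
  assumes "arithmetic_seq u" "0 \<le> x" "x < 1"
  shows "expansion u x (digit u x)"
  unfolding digit_def using expansion_exists[OF assms] expansion_unique[OF assms(1)]
  by (metis theI)

definition supp :: "(nat \<Rightarrow> int) \<Rightarrow> real \<Rightarrow> nat set" where
  "supp u x = {n. n \<ge> 1 \<and> digit u x n \<noteq> 0}"

definition supp_b :: "(nat \<Rightarrow> int) \<Rightarrow> real \<Rightarrow> nat set" where
  "supp_b u x = {n. n \<ge> 1 \<and> int (digit u x n) = ratio u n - 1}"

definition b_bounded :: "(nat \<Rightarrow> int) \<Rightarrow> nat set \<Rightarrow> bool" where
  "b_bounded u A \<longleftrightarrow> A \<subseteq> {1..} \<and> bdd_above (ratio u ` A)"

definition b_divergent :: "(nat \<Rightarrow> int) \<Rightarrow> nat set \<Rightarrow> bool" where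
  "b_divergent u A \<longleftrightarrow> A \<subseteq> {1..} \<and> filterlim (ratio u) at_top (along A)"

definition b_bounded_mod :: "nat set set \<Rightarrow> (nat \<Rightarrow> int) \<Rightarrow> nat set \<Rightarrow> bool" where
  "b_bounded_mod I u X \<longleftrightarrow> (\<exists>A. b_bounded u A \<and> subset_mod I A X)"

definition b_divergent_mod :: "nat set set \<Rightarrow> (nat \<Rightarrow> int) \<Rightarrow> nat set \<Rightarrow> bool" where
  "b_divergent_mod I u X \<longleftrightarrow> (\<exists>A. b_divergent u A \<and> subset_mod I A X)"

definition splitting_witness ::
    "nat set set \<Rightarrow> (nat \<Rightarrow> int) \<Rightarrow> nat set \<Rightarrow> nat set \<Rightarrow> bool" where
  "splitting_witness I u B D \<longleftrightarrow>
     B \<union> D = {1..} \<and> B \<inter> D = {} \<and>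
     (B = {} \<or> B \<notin> I) \<and> (D = {} \<or> D \<notin> I) \<and>
     (B \<notin> I \<longrightarrow> b_bounded_mod I u B) \<and>
     (D \<notin> I \<longrightarrow> b_divergent_mod I u D)"

end

theory Submission
  imports Defs
begin

text \<open>
  Let \<open>r n\<close> be the fractional part of \<open>u (n - 1) * x\<close>, so that \<open>r n = (c n + r (n + 1)) / b n\<close>.
  \<open>I\<close>-convergence is convergence along the filter dual to \<open>I\<close>, and the \<open>P\<close>-property lets one
  replace convergence along that filter by convergence along a set that is large modulo \<open>I\<close>.
  On \<open>D\<close> the term \<open>r (n + 1) / b n\<close> vanishes in the limit, so \<open>r n\<close> tends to an integer iff
  \<open>c n / b n\<close> does.  On \<open>B\<close> the ratios are bounded, so \<open>r n\<close> can only be close to 1 on \<open>S\<close> and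
  close to 0 off \<open>S\<close>, and this forces the same on \<open>r (n + 1)\<close>.  Conversely, on \<open>B\<close> each step from
  \<open>n + 1\<close> back to \<open>n\<close> at least halves the distance to 1 (respectively 0), and a step into \<open>D\<close>
  makes it small, so iterating the step gives convergence.
\<close>

section \<open>The dual filter of an ideal and limits along it\<close>

definition dual_filter :: "nat set set \<Rightarrow> nat filter" where
  "dual_filter I = Abs_filter (\<lambda>P. {n. \<not> P n} \<in> I)"

lemma ideal_subset: "is_ideal I \<Longrightarrow> A \<in> I \<Longrightarrow> B \<subseteq> A \<Longrightarrow> B \<in> I"
  by (auto simp: is_ideal_def)

lemma eventually_dual_filter:
  assumes "is_ideal I"
  shows "eventually P (dual_filter I) \<longleftrightarrow> {n. \<not> P n} \<in> I"
  unfolding dual_filter_def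
proof (rule eventually_Abs_filter)
  show "is_filter (\<lambda>P. {n. \<not> P n} \<in> I)"
  proof
    obtain A where "A \<in> I" using assms by (auto simp: is_ideal_def)
    then show "{n. \<not> True} \<in> I" by (rule ideal_subset[OF assms]) simp
  next
    fix P Q :: "nat \<Rightarrow> bool"
    assume "{n. \<not> P n} \<in> I" "{n. \<not> Q n} \<in> I"
    then have "{n. \<not> P n} \<union> {n. \<not> Q n} \<in> I" using assms by (auto simp: is_ideal_def)
    then show "{n. \<not> (P n \<and> Q n)} \<in> I" by (rule ideal_subset[OF assms]) auto
  next
    fix P Q :: "nat \<Rightarrow> bool"
    assume "\<forall>n. P n \<longrightarrow> Q n" and "{n. \<not> P n} \<in> I"
    from this(2) show "{n. \<not> Q n} \<in> I"
      by (rule ideal_subset[OF assms]) (use \<open>\<forall>n. P n \<longrightarrow> Q n\<close> in auto)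
  qed
qed

lemma eventually_dual_filter_imp:
  assumes "is_ideal I"
  shows "eventually (\<lambda>n. n \<in> X \<longrightarrow> n \<in> Y) (dual_filter I) \<longleftrightarrow> X - Y \<in> I"
  by (simp add: eventually_dual_filter[OF assms] set_diff_eq)

lemma dual_filter_le_sequentially:
  assumes "free_ideal I"
  shows "dual_filter I \<le> sequentially"
proof (rule filter_leI)
  fix P assume "eventually P sequentially"
  then have "finite {n. \<not> P n}" by (simp add: eventually_cofinite flip: cofinite_eq_sequentially)
  with assms show "eventually P (dual_filter I)"
    by (simp add: eventually_dual_filter free_ideal_def)
qed

text \<open>The two exceptional sets are translates of each other by 1 and by -1, up to the point 0,
  so translation invariance in both directions applies.\<close>

lemma dual_filter_Suc:
  assumes "is_ideal I" "translation_invariant I" "free_ideal I"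
  shows "eventually (\<lambda>n. P (Suc n)) (dual_filter I) \<longleftrightarrow> eventually P (dual_filter I)"
proof
  assume "eventually (\<lambda>n. P (Suc n)) (dual_filter I)"
  then have "shift {n. \<not> P (Suc n)} 1 \<in> I"
    using assms by (simp add: eventually_dual_filter translation_invariant_def)
  \<comment> \<open>The translate by 1 never contains 0, so a failure of \<open>P\<close> at 0 has
    to be covered separately; freeness does this.\<close>
  moreover have "{0} \<in> I" using assms(3) by (simp add: free_ideal_def)
  ultimately have "shift {n. \<not> P (Suc n)} 1 \<union> {0} \<in> I"
    using assms(1) unfolding is_ideal_def by blast
  moreover have "{n. \<not> P n} \<subseteq> shift {n. \<not> P (Suc n)} 1 \<union> {0}"
  proof
    fix n assume "n \<in> {n. \<not> P n}"
    then show "n \<in> shift {n. \<not> P (Suc n)} 1 \<union> {0}"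
      by (cases n) (auto simp: shift_def)
  qed
  ultimately show "eventually P (dual_filter I)"
    unfolding eventually_dual_filter[OF assms(1)] by (rule ideal_subset[OF assms(1)])
next
  assume "eventually P (dual_filter I)"
  then have "shift {n. \<not> P n} (- 1) \<in> I"
    using assms by (simp add: eventually_dual_filter translation_invariant_def)
  moreover have "{n. \<not> P (Suc n)} \<subseteq> shift {n. \<not> P n} (- 1)"
    by (auto simp: shift_def intro!: bexI[of _ "Suc _"])
  ultimately show "eventually (\<lambda>n. P (Suc n)) (dual_filter I)"
    unfolding eventually_dual_filter[OF assms(1)] by (rule ideal_subset[OF assms(1)])
qed

lemma tendsto_dual_filter_Suc:
  assumes "is_ideal I" "translation_invariant I" "free_ideal I"
  shows "((\<lambda>n. f (Suc n)) \<longlongrightarrow> l) (dual_filter I) \<longleftrightarrow> (f \<longlongrightarrow> l) (dual_filter I)"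
  unfolding tendsto_def by (subst dual_filter_Suc[OF assms, of "\<lambda>n. f n \<in> S" for S]) (rule refl)

lemma almost_subset_shift_iff:
  assumes "is_ideal I" "translation_invariant I" "free_ideal I"
  shows "almost_subset I (shift X 1) Y \<longleftrightarrow> (\<forall>\<^sub>F n in dual_filter I. n \<in> X \<longrightarrow> Suc n \<in> Y)"
proof -
  have "Suc n \<in> shift X 1 \<longleftrightarrow> n \<in> X" for n by (auto simp: shift_def)
  then show ?thesis
    using dual_filter_Suc[OF assms, of "\<lambda>n. n \<in> shift X 1 \<longrightarrow> n \<in> Y"]
    by (simp add: almost_subset_def eventually_dual_filter_imp[OF assms(1)])
qed

text \<open>Transfers limits along one large subset \<open>C\<close> to the trace of the dual filter
  on \<open>X\<close>: the trace contains \<open>C\<close> because \<open>X - C\<close> is in the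
  ideal, and it refines \<open>sequentially\<close> by freeness.\<close>

lemma inf_dual_filter_le_along:
  assumes "free_ideal I" "subset_mod I C X"
  shows "inf (dual_filter I) (principal X) \<le> along C"
proof -
  have I: "is_ideal I" using assms(1) by (simp add: free_ideal_def)
  have "eventually (\<lambda>n. n \<in> X \<longrightarrow> n \<in> C) (dual_filter I)"
    using assms(2) by (simp add: subset_mod_def eventually_dual_filter_imp[OF I])
  then have "inf (dual_filter I) (principal X) \<le> principal C"
    by (simp add: le_principal eventually_inf_principal)
  moreover have "inf (dual_filter I) (principal X) \<le> sequentially"
    using dual_filter_le_sequentially[OF assms(1)] by (rule le_infI1)
  ultimately show ?thesis by (simp add: along_def)
qed

text \<open>For each k the points of \<open>X\<close> at distance at least 1/(k+1) from the limit
  form a set of the ideal. The P-property gives one \<open>U\<close> in the ideal containing all but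
  finitely many points of each of these sets, and \<open>X - U\<close> is the required
  \<open>C\<close>. The guard \<open>X \<notin> I\<close> fits because the trace on a set of the
  ideal is the trivial filter, along which every limit holds.\<close>

lemma P_ideal_tendsto_iff:
  fixes f :: "nat \<Rightarrow> 'a::metric_space"
  assumes free: "free_ideal I" and P: "P_ideal I"
  shows "(f \<longlongrightarrow> l) (inf (dual_filter I) (principal X)) \<longleftrightarrow>
    (X \<notin> I \<longrightarrow> (\<exists>C. subset_mod I C X \<and> (f \<longlongrightarrow> l) (along C)))"
proof
  have I: "is_ideal I" using free by (simp add: free_ideal_def)
  assume lim: "(f \<longlongrightarrow> l) (inf (dual_filter I) (principal X))"
  define A where "A k = {n \<in> X. \<not> dist (f n) l < 1 / real (Suc k)}" for k
  have "A k \<in> I" for k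
  proof -
    have "\<forall>\<^sub>F n in dual_filter I. n \<in> X \<longrightarrow> dist (f n) l < 1 / real (Suc k)"
      using tendstoD[OF lim, of "1 / real (Suc k)"] by (simp add: eventually_inf_principal)
    then show ?thesis by (simp add: eventually_dual_filter[OF I] A_def)
  qed
  then have "range A \<subseteq> I" by auto
  then obtain U where U: "U \<in> I" "\<And>k. finite (A k - U)"
    using P unfolding P_ideal_def by meson
  have "subset_mod I (X - U) X"
    using U(1) ideal_subset[OF I, of U "X - (X - U)"] by (auto simp: subset_mod_def)
  moreover have "(f \<longlongrightarrow> l) (along (X - U))"
  proof (rule tendstoI)
    fix e :: real assume "e > 0"
    then obtain k where k: "1 / real (Suc k) < e" by (rule nat_approx_posE)
    have "\<forall>\<^sub>F n in sequentially. n \<notin> A k - U"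
      unfolding cofinite_eq_sequentially[symmetric] eventually_cofinite not_not Collect_mem_eq
      by (rule U(2))
    then have "\<forall>\<^sub>F n in sequentially. n \<in> X - U \<longrightarrow> dist (f n) l < e"
      by eventually_elim (use k in \<open>auto simp: A_def\<close>)
    then show "\<forall>\<^sub>F n in along (X - U). dist (f n) l < e"
      by (simp add: along_def eventually_inf_principal)
  qed
  ultimately show "X \<notin> I \<longrightarrow> (\<exists>C. subset_mod I C X \<and> (f \<longlongrightarrow> l) (along C))" by blast
next
  have I: "is_ideal I" using free by (simp add: free_ideal_def)
  assume R: "X \<notin> I \<longrightarrow> (\<exists>C. subset_mod I C X \<and> (f \<longlongrightarrow> l) (along C))"
  show "(f \<longlongrightarrow> l) (inf (dual_filter I) (principal X))"
  proof (cases "X \<in> I")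
    case True
    then have "\<forall>\<^sub>F n in dual_filter I. n \<notin> X" by (simp add: eventually_dual_filter[OF I])
    then have "inf (dual_filter I) (principal X) = bot"
      by (simp add: trivial_limit_def eventually_inf_principal)
    then show ?thesis by simp
  next
    case False
    with R obtain C where "subset_mod I C X" "(f \<longlongrightarrow> l) (along C)" by blast
    then show ?thesis using tendsto_mono[OF inf_dual_filter_le_along[OF free]] by metis
  qed
qed

section \<open>Distance to the nearest integer and convergence to 0 in the circle\<close>

definition circle_norm :: "real \<Rightarrow> real" where
  "circle_norm t = min (frac t) (1 - frac t)"

lemma circle_norm_nonneg: "0 \<le> circle_norm t"
  using frac_lt_1[of t] by (simp add: circle_norm_def)

text \<open>The two terms of the minimum are the distances to the floor of \<open>t\<close> and to
  the floor plus 1. Every integer is at most the first or at least the second, so none is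
  closer.\<close>

lemma circle_norm_less_iff:
  assumes "e > 0"
  shows "circle_norm t < e \<longleftrightarrow> (\<exists>k::int. \<bar>t - of_int k\<bar> < e)"
proof
  assume "circle_norm t < e"
  then consider "frac t < e" | "1 - frac t < e" by (auto simp: circle_norm_def min_less_iff_disj)
  then show "\<exists>k::int. \<bar>t - of_int k\<bar> < e"
  proof cases
    case 1 then show ?thesis
      using frac_ge_0[of t] by (intro exI[of _ "\<lfloor>t\<rfloor>"]) (auto simp: frac_def)
  next
    case 2 then show ?thesis
      using frac_lt_1[of t] by (intro exI[of _ "\<lfloor>t\<rfloor> + 1"]) (auto simp: frac_def)
  qed
next
  assume "\<exists>k::int. \<bar>t - of_int k\<bar> < e"
  then obtain k :: int where k: "\<bar>t - of_int k\<bar> < e" by blast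
  show "circle_norm t < e"
  proof (cases "of_int k \<le> t")
    case True
    then have "real_of_int k \<le> of_int \<lfloor>t\<rfloor>" by (simp add: le_floor_iff)
    then show ?thesis using k True by (auto simp: circle_norm_def frac_def min_less_iff_disj)
  next
    case False
    then have "\<lfloor>t\<rfloor> < k" by (simp add: floor_less_iff)
    then have "of_int \<lfloor>t\<rfloor> + 1 \<le> real_of_int k" by linarith
    then show ?thesis using k False by (auto simp: circle_norm_def frac_def min_less_iff_disj)
  qed
qed

lemma proj_eq_iff: "proj s = proj t \<longleftrightarrow> s - t \<in> \<int>"
  using circle.abs_eq_iff[of s t] by (simp add: cong_int_def)

text \<open>Replaces a limit in the quotient topology by a real one, to which metric arguments such
  as \<open>P_ideal_tendsto_iff\<close> apply.\<close>

lemma tendsto_proj_zero_iff: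
  "((\<lambda>n. proj (g n)) \<longlongrightarrow> 0) F \<longleftrightarrow> ((\<lambda>n. circle_norm (g n)) \<longlongrightarrow> 0) F"
proof
  assume lim: "((\<lambda>n. proj (g n)) \<longlongrightarrow> 0) F"
  show "((\<lambda>n. circle_norm (g n)) \<longlongrightarrow> 0) F"
  proof (rule tendstoI)
    fix e :: real assume e: "e > 0"
    \<comment> \<open>This union of balls around the integers is open and invariant under integer
      translations, so it is the full preimage of its image, and that image is an open neighbourhood
      of 0.\<close>
    define V where "V = {t. \<exists>k::int. \<bar>t - of_int k\<bar> < e}"
    have V: "proj s \<in> proj ` V \<longleftrightarrow> s \<in> V" for s
    proof
      assume "proj s \<in> proj ` V"
      then obtain t k where t: "s - t \<in> \<int>" "\<bar>t - of_int k\<bar> < e"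
        by (auto simp: proj_eq_iff V_def)
      then obtain j where "s - t = of_int j" by (auto elim: Ints_cases)
      then show "s \<in> V" using t by (auto simp: V_def intro!: exI[of _ "j + k"])
    qed auto
    have "V = (\<Union>k::int. ball (of_int k) e)"
      by (auto simp: V_def dist_real_def abs_minus_commute)
    then have "open V" by auto
    moreover have "proj -` (proj ` V) = V" using V by blast
    ultimately have "open (proj ` V)" by (simp add: open_circle_def)
    moreover have "0 \<in> proj ` V"
      using e by (auto simp: zero_circle_def V_def intro!: imageI exI[of _ 0])
    ultimately have "\<forall>\<^sub>F n in F. proj (g n) \<in> proj ` V" using topological_tendstoD[OF lim] by blast
    then have "\<forall>\<^sub>F n in F. circle_norm (g n) < e"
      unfolding V by (simp add: V_def circle_norm_less_iff[OF e])
    then show "\<forall>\<^sub>F n in F. dist (circle_norm (g n)) 0 < e"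
      using circle_norm_nonneg by (simp add: dist_real_def)
  qed
next
  assume lim: "((\<lambda>n. circle_norm (g n)) \<longlongrightarrow> 0) F"
  show "((\<lambda>n. proj (g n)) \<longlongrightarrow> 0) F"
  proof (rule topological_tendstoI)
    fix U :: "circle set" assume "open U" "0 \<in> U"
    then have "open (proj -` U)" "0 \<in> proj -` U" by (auto simp: open_circle_def zero_circle_def)
    then obtain e where "e > 0" "\<forall>t. dist t 0 < e \<longrightarrow> t \<in> proj -` U"
      unfolding open_dist by blast
    then have e: "e > 0" "\<And>t. \<bar>t\<bar> < e \<Longrightarrow> proj t \<in> U" by (simp_all add: dist_real_def)
    have "\<forall>\<^sub>F n in F. circle_norm (g n) < e"
      using order_tendstoD(2)[OF lim e(1)] .
    then show "\<forall>\<^sub>F n in F. proj (g n) \<in> U"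
    proof eventually_elim
      case (elim n)
      then obtain k :: int where k: "\<bar>g n - of_int k\<bar> < e" using circle_norm_less_iff[OF e(1)] by blast
      have "proj (g n) = proj (g n - of_int k)" by (simp add: proj_eq_iff)
      then show ?case using e(2)[OF k] by simp
    qed
  qed
qed

section \<open>Remainders satisfying a digit recursion, along a filter stable under
  successors\<close>

lemma tendsto_inf_principal_iff:
  fixes f :: "nat \<Rightarrow> 'a::metric_space"
  shows "(f \<longlongrightarrow> l) (inf F (principal X)) \<longleftrightarrow>
    (\<forall>e>0. \<forall>\<^sub>F n in F. n \<in> X \<longrightarrow> dist (f n) l < e)"
  by (simp add: tendsto_iff eventually_inf_principal)

text \<open>The contraction step of the later inductions on \<open>k\<close>: halving the distance
  halves the power of 1/2 and keeps the tolerance \<open>e\<close>, since e/2 < e.\<close>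

lemma less_add_half_power:
  fixes e s t :: real
  assumes "s < e + (1 / 2) ^ k" "t \<le> s / 2" "e > 0"
  shows "t < e + (1 / 2) ^ Suc k"
proof -
  obtain p :: real where p: "p = (1 / 2) ^ k" by simp
  have "s < e + p" using assms(1) p by simp
  then have "t < e + p / 2" using assms(2,3) by linarith
  then show ?thesis by (simp add: p)
qed

text \<open>Separates the analytic argument from ideals and expansions. Divergence on
  \<open>D\<close> is stated as vanishing of \<open>1 / b n\<close>, because this quotient bounds
  the error when \<open>r n\<close> is replaced by \<open>c n / b n\<close>.\<close>

locale remainders =
  fixes F :: "nat filter" and b :: "nat \<Rightarrow> int" and c :: "nat \<Rightarrow> nat" and r :: "nat \<Rightarrow> real"
    and B D S :: "nat set" and M :: real
  assumes eventually_Suc: "eventually P F \<Longrightarrow> eventually (\<lambda>n. P (Suc n)) F"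
    and eventually_pos: "\<forall>\<^sub>F n in F. n \<ge> 1"
    and b_ge: "n \<ge> 1 \<Longrightarrow> b n \<ge> 2"
    and c_less: "n \<ge> 1 \<Longrightarrow> int (c n) < b n"
    and r_ge: "0 \<le> r n" and r_less: "r n < 1"
    and r_eq: "n \<ge> 1 \<Longrightarrow> r n = (real (c n) + r (Suc n)) / of_int (b n)"
    and S_iff: "n \<ge> 1 \<Longrightarrow> n \<in> S \<longleftrightarrow> c n \<noteq> 0"
    and BD: "n \<in> B \<or> n \<in> D \<longleftrightarrow> n \<ge> 1" "\<not> (n \<in> B \<and> n \<in> D)"
    and bounded: "\<forall>\<^sub>F n in F. n \<in> B \<longrightarrow> of_int (b n) \<le> M"
    and divergent: "((\<lambda>n. 1 / of_int (b n) :: real) \<longlongrightarrow> 0) (inf F (principal D))"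
    and M_ge: "M \<ge> 2"
begin

lemma b_ge_real: "n \<ge> 1 \<Longrightarrow> real_of_int (b n) \<ge> 2"
  using b_ge[of n] by linarith

lemma c_le_real: "n \<ge> 1 \<Longrightarrow> real (c n) + 1 \<le> of_int (b n)"
  using c_less[of n] by linarith

lemma remainder_bounds:
  assumes "n \<ge> 1"
  shows "real (c n) / of_int (b n) \<le> r n"
    and "r n \<le> real (c n) / of_int (b n) + 1 / of_int (b n)"
    and "real (c n) / of_int (b n) + 1 / of_int (b n) \<le> 1"
    and "r n = real (c n) / of_int (b n) + r (Suc n) / of_int (b n)"
  using r_eq[OF assms] r_ge[of "Suc n"] r_less[of "Suc n"] b_ge_real[OF assms] c_le_real[OF assms]
  by (simp_all add: divide_right_mono field_simps)

lemma divergent_less: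
  assumes "e > 0"
  shows "\<forall>\<^sub>F n in F. n \<in> D \<longrightarrow> 1 / real_of_int (b n) < e"
proof -
  have "\<forall>\<^sub>F n in F. n \<in> D \<longrightarrow> dist (1 / real_of_int (b n)) 0 < e"
    using divergent assms by (simp add: tendsto_inf_principal_iff)
  then show ?thesis by eventually_elim (auto simp only: dist_real_def diff_0_right abs_less_iff)
qed

section \<open>Necessity of the conditions\<close>

context
  assumes null: "((\<lambda>n. min (r n) (1 - r n)) \<longlongrightarrow> 0) F"
begin

lemma null_less: "e > 0 \<Longrightarrow> \<forall>\<^sub>F n in F. r n < e \<or> 1 - r n < e"
  using order_tendstoD(2)[OF null, of e] by (simp add: min_less_iff_disj)

text \<open>A nonzero digit on \<open>B\<close> gives \<open>r n\<close> at least 1/M, so a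
  remainder close to an integer must be close to 1. A digit below \<open>b n - 1\<close> would keep
  it at distance at least 1/M from 1. With the top digit, passing to \<open>r (Suc n)\<close>
  multiplies the distance to 1 by \<open>b n\<close>, hence by at most \<open>M\<close>.\<close>

lemma null_imp_near_one:
  assumes "e > 0"
  shows "\<forall>\<^sub>F n in F. n \<in> B \<inter> S \<longrightarrow> int (c n) = b n - 1 \<and> 1 - r (Suc n) < e"
proof -
  \<comment> \<open>The bound d <= 1/M excludes small digits and remainders near 0; M * d <= e
    absorbs the factor \<open>b n\<close>.\<close>
  define d where "d = min e 1 / M"
  have d: "d > 0" "d \<le> 1 / M" "M * d \<le> e"
    using assms M_ge by (auto simp: d_def field_simps)
  show ?thesis
    using null_less[OF d(1)] bounded
  proof eventually_elim
    case (elim n)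
    show ?case
    proof
      assume n: "n \<in> B \<inter> S"
      then have n1: "n \<ge> 1" using BD by auto
      have bM: "real_of_int (b n) \<le> M" using elim(2) n by auto
      have b2: "real_of_int (b n) \<ge> 2" using b_ge_real[OF n1] .
      have inv: "1 / M \<le> 1 / real_of_int (b n)" using bM b2 by (intro divide_left_mono) auto
      have "c n \<ge> 1" using S_iff[OF n1] n by auto
      then have "1 / real_of_int (b n) \<le> real (c n) / of_int (b n)"
        using b2 by (intro divide_right_mono) auto
      then have "\<not> r n < d" using remainder_bounds(1)[OF n1] inv d by linarith
      then have near: "1 - r n < d" using elim(1) by auto
      have r': "1 - r n = (of_int (b n) - real (c n) - r (Suc n)) / of_int (b n)"
        using r_eq[OF n1] b2 by (simp add: field_simps)
      have cb: "int (c n) = b n - 1"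
      proof (rule ccontr)
        assume "int (c n) \<noteq> b n - 1"
        then have "int (c n) + 2 \<le> b n" using c_less[OF n1] by auto
        then have "real (c n) + 2 \<le> of_int (b n)" by linarith
        then have "1 / of_int (b n) \<le> 1 - r n"
          unfolding r' using b2 r_less[of "Suc n"] by (intro divide_right_mono) auto
        then show False using near inv d by linarith
      qed
      then have "real (c n) = of_int (b n) - 1" by linarith
      then have "1 - r (Suc n) = of_int (b n) * (1 - r n)" unfolding r' using b2 by simp
      also have "\<dots> \<le> M * (1 - r n)" using bM r_less[of n] by (intro mult_right_mono) auto
      also have "\<dots> < M * d" using near M_ge by (intro mult_strict_left_mono) auto
      finally show "int (c n) = b n - 1 \<and> 1 - r (Suc n) < e" using cb d by linarith
    qed
  qed
qed

text \<open>A zero digit gives \<open>r n\<close> at most 1/2, so being close to an integer means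
  being close to 0; the recursion then multiplies \<open>r n\<close> by \<open>b n\<close>, at most
  \<open>M\<close>.\<close>

lemma null_imp_near_zero:
  assumes "e > 0"
  shows "\<forall>\<^sub>F n in F. n \<in> B - S \<longrightarrow> r (Suc n) < e"
proof -
  define d where "d = min e 1 / M"
  have d: "d > 0" "d \<le> 1 / 2" "M * d \<le> e"
    using assms M_ge by (auto simp: d_def field_simps)
  show ?thesis
    using null_less[OF d(1)] bounded
  proof eventually_elim
    case (elim n)
    show ?case
    proof
      assume n: "n \<in> B - S"
      then have n1: "n \<ge> 1" using BD by auto
      have bM: "real_of_int (b n) \<le> M" using elim(2) n by auto
      have b2: "real_of_int (b n) \<ge> 2" using b_ge_real[OF n1] .
      have c0: "c n = 0" using S_iff[OF n1] n by auto
      have "1 / real_of_int (b n) \<le> 1 / 2" using b2 by (intro divide_left_mono) auto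
      then have "r n \<le> 1 / 2" using remainder_bounds(2)[OF n1] c0 by simp
      then have "r n < d" using elim(1) d by linarith
      have "r (Suc n) = of_int (b n) * r n" using r_eq[OF n1] c0 b2 by simp
      also have "\<dots> \<le> M * r n" using bM r_ge[of n] by (intro mult_right_mono) auto
      also have "\<dots> < M * d" using \<open>r n < d\<close> M_ge by (intro mult_strict_left_mono) auto
      finally show "r (Suc n) < e" using d by linarith
    qed
  qed
qed

lemma null_imp_conditions:
  shows "\<forall>\<^sub>F n in F. n \<in> B \<inter> S \<longrightarrow> Suc n \<in> S"
    and "\<forall>\<^sub>F n in F. n \<in> B \<inter> S \<longrightarrow> int (c n) = b n - 1"
    and "((\<lambda>n. (real (c (Suc n)) + 1) / of_int (b (Suc n))) \<longlongrightarrow> 1) (inf F (principal (B \<inter> S)))"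
    and "((\<lambda>n. real (c (Suc n)) / of_int (b (Suc n))) \<longlongrightarrow> 0) (inf F (principal (B - S)))"
    and "((\<lambda>n. min (real (c n) / of_int (b n)) (1 - real (c n) / of_int (b n))) \<longlongrightarrow> 0)
      (inf F (principal (D \<inter> S)))"
proof -
  \<comment> \<open>A zero digit at \<open>Suc n\<close> would force \<open>r (Suc n)\<close> to be
    at most 1/2, so tolerance 1/2 suffices to put \<open>Suc n\<close> in \<open>S\<close>.\<close>
  have "1 / 2 > (0::real)" by simp
  from null_imp_near_one[OF this]
  show "\<forall>\<^sub>F n in F. n \<in> B \<inter> S \<longrightarrow> Suc n \<in> S"
  proof eventually_elim
    case (elim n)
    have "1 / real_of_int (b (Suc n)) \<le> 1 / 2"
      using b_ge_real[of "Suc n"] by (intro divide_left_mono) auto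
    then show ?case using elim remainder_bounds(2)[of "Suc n"] S_iff[of "Suc n"] by auto
  qed
  show "\<forall>\<^sub>F n in F. n \<in> B \<inter> S \<longrightarrow> int (c n) = b n - 1"
    using null_imp_near_one[of 1] by (auto elim: eventually_mono)
  show "((\<lambda>n. (real (c (Suc n)) + 1) / of_int (b (Suc n))) \<longlongrightarrow> 1) (inf F (principal (B \<inter> S)))"
    unfolding tendsto_inf_principal_iff
  proof (intro allI impI)
    fix e :: real assume "e > 0"
    from null_imp_near_one[OF this]
    show "\<forall>\<^sub>F n in F. n \<in> B \<inter> S \<longrightarrow> dist ((real (c (Suc n)) + 1) / of_int (b (Suc n))) 1 < e"
    proof eventually_elim
      case (elim n)
      then show ?case
        \<comment> \<open>The quotient lies between \<open>r (Suc n)\<close> and 1.\<close>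
        using remainder_bounds(2,3)[of "Suc n"] by (auto simp: dist_real_def add_divide_distrib)
    qed
  qed
  show "((\<lambda>n. real (c (Suc n)) / of_int (b (Suc n))) \<longlongrightarrow> 0) (inf F (principal (B - S)))"
    unfolding tendsto_inf_principal_iff
  proof (intro allI impI)
    fix e :: real assume "e > 0"
    from null_imp_near_zero[OF this]
    show "\<forall>\<^sub>F n in F. n \<in> B - S \<longrightarrow> dist (real (c (Suc n)) / of_int (b (Suc n))) 0 < e"
    proof eventually_elim
      case (elim n)
      then show ?case
        using remainder_bounds(1)[of "Suc n"] b_ge_real[of "Suc n"] by (auto simp: dist_real_def)
    qed
  qed
  show "((\<lambda>n. min (real (c n) / of_int (b n)) (1 - real (c n) / of_int (b n))) \<longlongrightarrow> 0)
      (inf F (principal (D \<inter> S)))"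
    unfolding tendsto_inf_principal_iff
  proof (intro allI impI)
    fix e :: real assume "e > 0"
    \<comment> \<open>Half of the tolerance is for the remainder, the other half for its distance to
      the digit quotient, which is at most \<open>1 / b n\<close>.\<close>
    then have e: "e / 2 > 0" by simp
    show "\<forall>\<^sub>F n in F. n \<in> D \<inter> S \<longrightarrow>
      dist (min (real (c n) / of_int (b n)) (1 - real (c n) / of_int (b n))) 0 < e"
      using null_less[OF e] divergent_less[OF e] eventually_pos
    proof eventually_elim
      case (elim n)
      show ?case
      proof
        assume "n \<in> D \<inter> S"
        then have "1 / real_of_int (b n) < e / 2" using elim(2) by blast
        then have "real (c n) / of_int (b n) < e \<or> 1 - real (c n) / of_int (b n) < e"
          using elim(1) remainder_bounds(1,2)[OF elim(3)] \<open>e > 0\<close> by linarith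
        moreover have "0 \<le> real (c n) / of_int (b n)" "real (c n) / of_int (b n) \<le> 1"
          using b_ge_real[of n] c_le_real[of n] elim(3) by simp_all
        ultimately show "dist (min (real (c n) / of_int (b n)) (1 - real (c n) / of_int (b n))) 0 < e"
          by (simp add: dist_real_def abs_of_nonneg min_less_iff_disj)
      qed
    qed
  qed
qed

end

section \<open>Sufficiency of the conditions\<close>

lemma near_one_iterated:
  assumes succ: "\<forall>\<^sub>F n in F. n \<in> B \<inter> S \<longrightarrow> Suc n \<in> S"
    and top: "\<forall>\<^sub>F n in F. n \<in> B \<inter> S \<longrightarrow> int (c n) = b n - 1"
    and lim: "((\<lambda>n. (real (c (Suc n)) + 1) / of_int (b (Suc n))) \<longlongrightarrow> 1) (inf F (principal (B \<inter> S)))"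
    and e: "e > 0"
  shows "\<forall>\<^sub>F n in F. n \<in> B \<inter> S \<longrightarrow> 1 - r n < e + (1 / 2) ^ k"
\<comment> \<open>Each step looks one index ahead, where \<open>eventually_Suc\<close> makes the
  induction hypothesis available. At k = 0 the bound is trivial, as remainders lie in [0,1).\<close>
proof (induction k)
  case 0
  have "1 - r n < e + 1" for n using e r_ge[of n] by linarith
  then show ?case by simp
next
  case (Suc k)
  have e2: "e / 2 > 0" using e by simp
  have lim': "\<forall>\<^sub>F n in F. n \<in> B \<inter> S \<longrightarrow>
      dist ((real (c (Suc n)) + 1) / of_int (b (Suc n))) 1 < e / 2"
    using lim e2 unfolding tendsto_inf_principal_iff by blast
  show ?case
    using eventually_Suc[OF Suc] succ top lim' eventually_Suc[OF divergent_less[OF e2]]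
  proof eventually_elim
    case (elim n)
    show ?case
    proof
      assume n: "n \<in> B \<inter> S"
      then have n1: "n \<ge> 1" using BD by auto
      have b2: "real_of_int (b n) \<ge> 2" using b_ge_real[OF n1] .
      have "int (c n) = b n - 1" using elim(3) n by blast
      then have "real (c n) = of_int (b n) - 1" by linarith
      then have "1 - r n = (1 - r (Suc n)) / of_int (b n)"
        using r_eq[OF n1] b2 by (simp add: field_simps)
      also have "\<dots> \<le> (1 - r (Suc n)) / 2"
        using b2 r_less[of "Suc n"] by (intro divide_left_mono) auto
      finally have half: "1 - r n \<le> (1 - r (Suc n)) / 2" .
      \<comment> \<open>If \<open>Suc n\<close> is in \<open>B\<close>, it is also in
        \<open>S\<close> and the induction hypothesis applies. In \<open>D\<close> the limit
        hypothesis controls the remainder directly, up to an error of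
        \<open>1 / b (Suc n)\<close>.\<close>
      have "1 - r (Suc n) < e + (1 / 2) ^ k"
      proof (cases "Suc n \<in> B")
        case True
        then show ?thesis using elim n by blast
      next
        case False
        then have "Suc n \<in> D" using BD(1)[of "Suc n"] by auto
        then have "1 / real_of_int (b (Suc n)) < e / 2" using elim by blast
        moreover have "\<bar>(real (c (Suc n)) + 1) / of_int (b (Suc n)) - 1\<bar> < e / 2"
          using elim(4) n by (simp add: dist_real_def)
        ultimately have "1 - r (Suc n) < e"
          using remainder_bounds(1)[of "Suc n"] unfolding add_divide_distrib by linarith
        moreover have "0 \<le> (1 / 2 :: real) ^ k" by simp
        ultimately show ?thesis by linarith
      qed
      then show "1 - r n < e + (1 / 2) ^ Suc k" using less_add_half_power half e by blast
    qed
  qed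
qed

text \<open>The same halving induction, towards 0. That an index of \<open>B\<close> following one
  in \<open>B - S\<close> is eventually again outside \<open>S\<close> is derived from the limit
  hypothesis.\<close>

lemma near_zero_iterated:
  assumes lim: "((\<lambda>n. real (c (Suc n)) / of_int (b (Suc n))) \<longlongrightarrow> 0) (inf F (principal (B - S)))"
    and e: "e > 0"
  shows "\<forall>\<^sub>F n in F. n \<in> B - S \<longrightarrow> r n < e + (1 / 2) ^ k"
proof (induction k)
  case 0
  have "r n < e + 1" for n using e r_less[of n] by linarith
  then show ?case by simp
next
  case (Suc k)
  have e2: "e / 2 > 0" using e by simp
  \<comment> \<open>A nonzero digit at an index of \<open>B\<close> makes the digit quotient at
    least 1/M, so the second threshold forces the digit at \<open>Suc n\<close> to vanish when
    \<open>Suc n\<close> is in \<open>B\<close>.\<close>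
  have "min (e / 2) (1 / M) > 0" using e M_ge by simp
  then have lim': "\<forall>\<^sub>F n in F. n \<in> B - S \<longrightarrow>
      dist (real (c (Suc n)) / of_int (b (Suc n))) 0 < min (e / 2) (1 / M)"
    using lim unfolding tendsto_inf_principal_iff by blast
  show ?case
    using eventually_Suc[OF Suc] lim' eventually_Suc[OF divergent_less[OF e2]] eventually_Suc[OF bounded]
  proof eventually_elim
    case (elim n)
    show ?case
    proof
      assume n: "n \<in> B - S"
      then have n1: "n \<ge> 1" using BD by auto
      have b2: "real_of_int (b n) \<ge> 2" using b_ge_real[OF n1] .
      have b2': "real_of_int (b (Suc n)) \<ge> 2" using b_ge_real[of "Suc n"] by simp
      have "c n = 0" using S_iff[OF n1] n by auto
      then have "r n = r (Suc n) / of_int (b n)" using r_eq[OF n1] by simp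
      also have "\<dots> \<le> r (Suc n) / 2"
        using b2 r_ge[of "Suc n"] by (intro divide_left_mono) auto
      finally have half: "r n \<le> r (Suc n) / 2" .
      have small: "real (c (Suc n)) / of_int (b (Suc n)) < e / 2"
        "real (c (Suc n)) / of_int (b (Suc n)) < 1 / M"
        using elim(2) n b2' by (simp_all add: dist_real_def)
      have "r (Suc n) < e + (1 / 2) ^ k"
      proof (cases "Suc n \<in> B")
        case True
        have "Suc n \<notin> S"
        proof
          assume "Suc n \<in> S"
          then have "c (Suc n) \<ge> 1" using S_iff[of "Suc n"] by auto
          then have "1 / real_of_int (b (Suc n)) \<le> real (c (Suc n)) / of_int (b (Suc n))"
            using b2' by (intro divide_right_mono) auto
          moreover have "1 / M \<le> 1 / real_of_int (b (Suc n))"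
            using elim(4) True b2' by (intro divide_left_mono) auto
          ultimately show False using small by linarith
        qed
        then show ?thesis using elim True by blast
      next
        case False
        then have "Suc n \<in> D" using BD(1)[of "Suc n"] by auto
        then have "1 / real_of_int (b (Suc n)) < e / 2" using elim by blast
        then have "r (Suc n) < e" using small remainder_bounds(2)[of "Suc n"] by linarith
        moreover have "0 \<le> (1 / 2 :: real) ^ k" by simp
        ultimately show ?thesis by linarith
      qed
      then show "r n < e + (1 / 2) ^ Suc k" using less_add_half_power half e by blast
    qed
  qed
qed

theorem null_iff:
  "((\<lambda>n. min (r n) (1 - r n)) \<longlongrightarrow> 0) F \<longleftrightarrow>
    (\<forall>\<^sub>F n in F. n \<in> B \<inter> S \<longrightarrow> Suc n \<in> S) \<and>
    (\<forall>\<^sub>F n in F. n \<in> B \<inter> S \<longrightarrow> int (c n) = b n - 1) \<and>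
    ((\<lambda>n. (real (c (Suc n)) + 1) / of_int (b (Suc n))) \<longlongrightarrow> 1) (inf F (principal (B \<inter> S))) \<and>
    ((\<lambda>n. real (c (Suc n)) / of_int (b (Suc n))) \<longlongrightarrow> 0) (inf F (principal (B - S))) \<and>
    ((\<lambda>n. min (real (c n) / of_int (b n)) (1 - real (c n) / of_int (b n))) \<longlongrightarrow> 0)
      (inf F (principal (D \<inter> S)))"
    (is "?L \<longleftrightarrow> ?R1 \<and> ?R2 \<and> ?R3 \<and> ?R4 \<and> ?R5")
proof
  assume ?L then show "?R1 \<and> ?R2 \<and> ?R3 \<and> ?R4 \<and> ?R5" using null_imp_conditions by blast
next
  assume R: "?R1 \<and> ?R2 \<and> ?R3 \<and> ?R4 \<and> ?R5"
  show ?L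
  proof (rule tendstoI)
    fix e :: real assume "e > 0"
    then have e: "e / 2 > 0" by simp
    obtain k where k: "(1 / 2) ^ k < e / 2"
      using real_arch_pow_inv[OF e, of "1 / 2"] by auto
    have one: "\<forall>\<^sub>F n in F. n \<in> B \<inter> S \<longrightarrow> 1 - r n < e / 2 + (1 / 2) ^ k"
      using R by (intro near_one_iterated e) auto
    have zero: "\<forall>\<^sub>F n in F. n \<in> B - S \<longrightarrow> r n < e / 2 + (1 / 2) ^ k"
      using R by (intro near_zero_iterated e) auto
    have D: "\<forall>\<^sub>F n in F. n \<in> D \<inter> S \<longrightarrow>
        dist (min (real (c n) / of_int (b n)) (1 - real (c n) / of_int (b n))) 0 < e / 2"
      using R e unfolding tendsto_inf_principal_iff by blast
    show "\<forall>\<^sub>F n in F. dist (min (r n) (1 - r n)) 0 < e"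
      using one zero D divergent_less[OF e] eventually_pos
    proof eventually_elim
      case (elim n)
      note n = \<open>n \<ge> 1\<close>
      have "r n < e \<or> 1 - r n < e"
      proof (cases "n \<in> B")
        case True
        then show ?thesis using elim k by (cases "n \<in> S") auto
      next
        case False
        then have nD: "n \<in> D" using BD n by blast
        then have d: "1 / real_of_int (b n) < e / 2" using elim by blast
        show ?thesis
        proof (cases "n \<in> S")
          case True
          then have "dist (min (real (c n) / of_int (b n)) (1 - real (c n) / of_int (b n))) 0 < e / 2"
            using elim(3) nD by blast
          then have "min (real (c n) / of_int (b n)) (1 - real (c n) / of_int (b n)) < e / 2"
            by (simp only: dist_real_def diff_0_right abs_less_iff)
          then show ?thesis using d remainder_bounds(1,2)[OF n] unfolding min_less_iff_disj by linarith
        next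
          \<comment> \<open>On \<open>D - S\<close> the remainder is at most \<open>1 / b n\<close>,
            which is why the conditions say nothing about this set.\<close>
          case False
          then have "c n = 0" using S_iff[OF n] by simp
          then show ?thesis using d e remainder_bounds(2)[OF n] by simp
        qed
      qed
      then show ?case using r_ge[of n] r_less[of n] by (auto simp: dist_real_def min_def)
    qed
  qed
qed

end

section \<open>From expansions and ideals to the remainder recursion\<close>

lemma frac_expansion:
  assumes u: "arithmetic_seq u" and c: "expansion u x c"
  shows "frac (of_int (u n) * x) =
    (real (c (Suc n)) + frac (of_int (u (Suc n)) * x)) / of_int (ratio u (Suc n))"
proof -
  define P where "P n = (\<Sum>k<n. real (c (Suc k)) / of_int (u (Suc k)))" for n
  have pos: "real_of_int (u n) > 0" for n
    using arithmetic_seq_Suc(2)[OF u, of n] by linarith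
  have rec: "real_of_int (u (Suc n)) = of_int (ratio u (Suc n)) * of_int (u n)"
    using arithmetic_seq_Suc(1)[OF u, of n] by (metis of_int_mult)
  have rpos: "real_of_int (ratio u (Suc n)) \<ge> 2"
    using arithmetic_seq_Suc(3)[OF u, of n] by linarith
  \<comment> \<open>\<open>P n\<close> is the truncated expansion and \<open>u n * P n\<close> is
    the floor of \<open>u n * x\<close>, so the fractional part is the tail scaled by
    \<open>u n\<close>.\<close>
  have fr: "frac (of_int (u n) * x) = of_int (u n) * (x - P n)" for n
    using expansion_floor[OF u c, of n] by (simp add: frac_def P_def algebra_simps)
  have "P (Suc n) = P n + real (c (Suc n)) / of_int (u (Suc n))" by (simp add: P_def)
  then have "real_of_int (u (Suc n)) * (x - P (Suc n)) =
      of_int (u (Suc n)) * (x - P n) - real (c (Suc n))"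
    using pos[of "Suc n"] by (simp add: field_simps)
  also have "\<dots> = of_int (ratio u (Suc n)) * (of_int (u n) * (x - P n)) - real (c (Suc n))"
    by (simp add: rec mult.assoc)
  finally have "real_of_int (u (Suc n)) * (x - P (Suc n)) =
      of_int (ratio u (Suc n)) * (of_int (u n) * (x - P n)) - real (c (Suc n))" .
  then show ?thesis unfolding fr using rpos by (simp add: field_simps)
qed

lemma characterized_iff:
  assumes "is_ideal I"
  shows "proj x \<in> characterized I u \<longleftrightarrow>
    ((\<lambda>n. circle_norm (of_int (u n) * x)) \<longlongrightarrow> 0) (dual_filter I)"
proof -
  have "ideal_converges I X y \<longleftrightarrow> (X \<longlongrightarrow> y) (dual_filter I)" for X and y :: circle
  proof
    assume "ideal_converges I X y"
    then show "(X \<longlongrightarrow> y) (dual_filter I)"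
      by (auto simp: ideal_converges_def tendsto_def eventually_dual_filter[OF assms] eventually_nhds)
  next
    assume "(X \<longlongrightarrow> y) (dual_filter I)"
    then show "ideal_converges I X y"
      unfolding ideal_converges_def filterlim_iff eventually_dual_filter[OF assms] by blast
  qed
  then show ?thesis
    by (simp add: characterized_def int_mult.abs_eq tendsto_proj_zero_iff)
qed

theorem corollary1p13:
  fixes u :: "nat \<Rightarrow> int" and I :: "nat set set" and x :: real
    and B D S S\<^sub>b :: "nat set" and b :: "nat \<Rightarrow> int" and c :: "nat \<Rightarrow> nat"
  assumes "arithmetic_seq u"
    and "is_ideal I" and "free_ideal I" and "translation_invariant I" and "P_ideal I"
    and "0 \<le> x" and "x < 1"
    and "b = ratio u" and "c = digit u x" and "S = supp u x" and "S\<^sub>b = supp_b u x"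
    and "splitting_witness I u B D"
  shows "proj x \<in> characterized I u \<longleftrightarrow>
    (almost_subset I (shift (B \<inter> S) 1) S \<and>
     almost_subset I (B \<inter> S) S\<^sub>b \<and>
     (B \<inter> S \<notin> I \<longrightarrow>
       (\<exists>C. subset_mod I C (B \<inter> S) \<and>
         ((\<lambda>n. (real (c (n + 1)) + 1) / real_of_int (b (n + 1))) \<longlongrightarrow> 1) (along C)))) \<and>
    (B - S \<notin> I \<longrightarrow>
       (\<exists>C. subset_mod I C (B - S) \<and>
         ((\<lambda>n. real (c (n + 1)) / real_of_int (b (n + 1))) \<longlongrightarrow> 0) (along C))) \<and>
    (D \<inter> S \<notin> I \<longrightarrow>
       (\<exists>E. subset_mod I E (D \<inter> S) \<and>
         ((\<lambda>n. proj (real (c n) / real_of_int (b n))) \<longlongrightarrow> 0) (along E)))"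
proof -
  note u = assms(1) and I = assms(2) and free = assms(3) and inv = assms(4) and P = assms(5)
  define F where "F = dual_filter I"
  \<comment> \<open>The index is shifted so that \<open>c n\<close> is the leading digit of
    \<open>r n\<close>. Truncated subtraction gives \<open>r 0 = r 1\<close>, and the recursion is
    claimed from 1 on.\<close>
  define r where "r n = frac (of_int (u (n - 1)) * x)" for n
  have ex: "expansion u x c" using expansion_digit[OF u] assms by simp
  have BD: "B \<union> D = {1..}" "B \<inter> D = {}" and B: "B = {} \<or> b_bounded_mod I u B"
    and D: "D = {} \<or> b_divergent_mod I u D"
    using assms(12) by (auto simp: splitting_witness_def)
  have S: "n \<in> S \<longleftrightarrow> n \<ge> 1 \<and> c n \<noteq> 0" and S\<^sub>b: "n \<in> S\<^sub>b \<longleftrightarrow> n \<ge> 1 \<and> int (c n) = b n - 1" for n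
    by (simp_all add: assms supp_def supp_b_def)
  have b2: "b n \<ge> 2" if "n \<ge> 1" for n
    using arithmetic_seq_Suc(3)[OF u, of "n - 1"] that by (simp add: assms)
  \<comment> \<open>The bound holds on a subset of \<open>B\<close> that is large modulo the ideal,
    hence eventually along \<open>F\<close>; the maximum with 2 secures \<open>M_ge\<close>.\<close>
  obtain M where M: "\<forall>\<^sub>F n in F. n \<in> B \<longrightarrow> of_int (b n) \<le> M" "M \<ge> (2::real)"
  proof (cases "B = {}")
    case True then show ?thesis using that[of 2] by simp
  next
    case False
    then obtain A where A: "b_bounded u A" "subset_mod I A B"
      using B by (auto simp: b_bounded_mod_def)
    then obtain m where m: "\<And>n. n \<in> A \<Longrightarrow> b n \<le> m"
      by (auto simp: b_bounded_def bdd_above_def assms)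
    have "\<forall>\<^sub>F n in F. n \<in> B \<longrightarrow> n \<in> A"
      using A(2) by (simp add: F_def eventually_dual_filter_imp[OF I] subset_mod_def)
    then have "\<forall>\<^sub>F n in F. n \<in> B \<longrightarrow> of_int (b n) \<le> max 2 (real_of_int m)"
      by eventually_elim (use m in \<open>force simp: le_max_iff_disj\<close>)
    then show ?thesis using that by simp
  qed
  have div: "((\<lambda>n. 1 / of_int (b n) :: real) \<longlongrightarrow> 0) (inf F (principal D))"
  proof (cases "D = {}")
    case True then show ?thesis by simp
  next
    case False
    then obtain A where A: "b_divergent u A" "subset_mod I A D"
      using D by (auto simp: b_divergent_mod_def)
    then have "filterlim b at_top (along A)" by (simp add: b_divergent_def assms)
    then have "filterlim (\<lambda>n. real_of_int (b n)) at_top (along A)"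
      by (rule filterlim_compose[OF filterlim_real_of_int_at_top])
    then have "((\<lambda>n. 1 / real_of_int (b n)) \<longlongrightarrow> 0) (along A)"
      by (intro tendsto_divide_0[OF tendsto_const] filterlim_at_top_imp_at_infinity)
    then show ?thesis
      unfolding F_def by (rule tendsto_mono[OF inf_dual_filter_le_along[OF free A(2)]])
  qed
  interpret remainders F b c r B D S M
  proof
    show "eventually (\<lambda>n. Q (Suc n)) F" if "eventually Q F" for Q
      using that dual_filter_Suc[OF I inv free] by (simp add: F_def)
    show "\<forall>\<^sub>F n in F. n \<ge> 1"
      using dual_filter_le_sequentially[OF free] eventually_ge_at_top[of 1]
      unfolding F_def by (rule filter_leD)
    show "int (c n) < b n" if "n \<ge> 1" for n
      using ex that by (simp add: expansion_def assms)
    show "r n = (real (c n) + r (Suc n)) / of_int (b n)" if "n \<ge> 1" for n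
      using frac_expansion[OF u ex, of "n - 1"] that by (simp add: r_def assms(8))
    show "n \<in> B \<or> n \<in> D \<longleftrightarrow> n \<ge> 1" "\<not> (n \<in> B \<and> n \<in> D)" for n using BD by auto
  qed (use b2 S M div frac_lt_1 in \<open>auto simp: r_def\<close>)
  have "proj x \<in> characterized I u \<longleftrightarrow> ((\<lambda>n. circle_norm (of_int (u n) * x)) \<longlongrightarrow> 0) F"
    by (simp add: characterized_iff[OF I] F_def)
  \<comment> \<open>The norm at n is the minimum for \<open>r (Suc n)\<close>; translation
    invariance removes the shift.\<close>
  also have "\<dots> \<longleftrightarrow> ((\<lambda>n. min (r n) (1 - r n)) \<longlongrightarrow> 0) F"
  proof -
    have "circle_norm (of_int (u n) * x) = min (r (Suc n)) (1 - r (Suc n))" for n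
      by (simp add: circle_norm_def r_def)
    then show ?thesis
      using tendsto_dual_filter_Suc[OF I inv free, of "\<lambda>n. min (r n) (1 - r n)"] by (simp add: F_def)
  qed
  finally have L: "proj x \<in> characterized I u \<longleftrightarrow> ((\<lambda>n. min (r n) (1 - r n)) \<longlongrightarrow> 0) F" .
  have norm: "circle_norm (real (c n) / of_int (b n)) =
      min (real (c n) / of_int (b n)) (1 - real (c n) / of_int (b n))" if "n \<ge> 1" for n
  proof -
    have "frac (real (c n) / of_int (b n)) = real (c n) / of_int (b n)"
      using c_le_real[OF that] b_ge_real[OF that] by (simp add: frac_eq)
    then show ?thesis by (simp add: circle_norm_def)
  qed
  have R2: "almost_subset I (B \<inter> S) S\<^sub>b \<longleftrightarrow> (\<forall>\<^sub>F n in F. n \<in> B \<inter> S \<longrightarrow> int (c n) = b n - 1)"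
  proof -
    have "n \<in> B \<inter> S \<longrightarrow> n \<in> S\<^sub>b \<longleftrightarrow> n \<in> B \<inter> S \<longrightarrow> int (c n) = b n - 1" for n using S S\<^sub>b by auto
    then show ?thesis
      by (simp add: almost_subset_def F_def flip: eventually_dual_filter_imp[OF I])
  qed
  \<comment> \<open>Digit quotients at positive indices lie in [0,1), so they are their own
    fractional parts; indices in \<open>S\<close> are positive.\<close>
  have R5: "((\<lambda>n. min (real (c n) / of_int (b n)) (1 - real (c n) / of_int (b n))) \<longlongrightarrow> 0)
        (inf F (principal (D \<inter> S))) \<longleftrightarrow>
      ((\<lambda>n. circle_norm (real (c n) / of_int (b n))) \<longlongrightarrow> 0) (inf F (principal (D \<inter> S)))"
    by (rule tendsto_cong) (use norm S in \<open>auto simp: eventually_inf_principal\<close>)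
  \<comment> \<open>The circle limit in (3) first becomes a real limit of
    \<open>circle_norm\<close>; then the P-property turns all three limits along traces into limits
    along large subsets.\<close>
  show ?thesis
    unfolding L null_iff R2 R5
    unfolding F_def almost_subset_shift_iff[OF I inv free] tendsto_proj_zero_iff
      P_ideal_tendsto_iff[OF free P]
    by (simp add: conj_assoc)
qed

end
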